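(* Under the standing setting and Assumptions (A1), (A2), (A3) described in the context: (i) for every $\delta>0$, $\displaystyle\lim_{\epsilon\to0}\inf\{t\ge0: |X(t)-\bar X^{\rm c}(t)|>\delta\}=+\infty$ almost surely; (ii) there exists a function $T:(0,\epsilon_0)\to\mathbb N$ with $\lim_{\epsilon\to0}T(\epsilon)=+\infty$ such that for every $\delta>0$, $$\lim_{\epsilon\to0}P\Big\{\sup_{0\le t\le T(\epsilon)}|X(t)-\bar X^{\rm c}(t)|>\delta\Big\}=0.$$
   Context: Setting. Let $(\Omega,\mathcal F,P)$ be a complete probability space, $\epsilon_0>0$ fixed and $\epsilon\in(0,\epsilon_0)$ a small parameter. Consider the discrete-time system $$X_{k+1}=X_k+\epsilon f(X_k,Y_{k+1}),\quad k=0,1,2,\dots,\qquad X_0=x\in\mathbb R^n \text{ (deterministic)},$$ where $\{Y_k\}$ is an $\mathbb R^m$-valued stochastic sequence with state space $S_Y\subset\mathbb R^m$, and $f:\mathbb R^n\times\mathbb R^m\to\mathbb R^n$. (A1) $f(x,y)$ is continuous in $(x,y)$; for each $x$, $y\mapsto f(x,y)$ is bounded; and $f$ is locally Lipschitz in $x$ uniformly in $y$: for every compact $D\subset\mathbb R^n$ there is $k_D$ with $|f(x_1,y)-f(x_2,y)|\le k_D|x_1-x_2|$ for all $x_1,x_2\in D$, $y\in S_Y$. (A2) $\{Y_k\}$ is ergodic with invariant distribution $\mu$, in the sense that for each $x$, $\bar f(x):=\int_{S_Y}f(x,y)\mu(dy)=\lim_{N\to\infty}\frac1{N+1}\sum_{k=0}^N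 f(x,Y_{k+1})$ almost surely. Average systems: the discrete average system $\bar X^{\rm d}_{k+1}=\bar X^{\rm d}_k+\epsilon\bar f(\bar X^{\rm d}_k)$, and the continuous average system $\frac{d}{dt}\bar X^{\rm c}(t)=\bar f(\bar X^{\rm c}(t))$, both with initial value $\bar X^{\rm d}_0=\bar X^{\rm c}(0)=X_0=x$. (A3) The continuous average system has a solution on $[0,\infty)$. Continuous-time versions: with $t_k=\epsilon k$, define the piecewise constant processes $X(t)=X_k$ and $\bar X^{\rm d}(t)=\bar X^{\rm d}_k$ for $t_k\le t<t_{k+1}$ (these depend on $\epsilon$). *)

theory Defs
  imports "HOL-Probability.Probability"
begin

primrec Xd :: "('a::real_vector \<Rightarrow> 'b \<Rightarrow> 'a) \<Rightarrow> (nat \<Rightarrow> 'w \<Rightarrow> 'b) \<Rightarrow> real \<Rightarrow> 'a \<Rightarrow> nat \<Rightarrow> 'w \<Rightarrow> 'a" where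
  "Xd f Y \<epsilon> x 0 \<omega> = x"
| "Xd f Y \<epsilon> x (Suc k) \<omega> = Xd f Y \<epsilon> x k \<omega> + \<epsilon> *\<^sub>R f (Xd f Y \<epsilon> x k \<omega>) (Y (Suc k) \<omega>)"

definition Xt :: "('a::real_vector \<Rightarrow> 'b \<Rightarrow> 'a) \<Rightarrow> (nat \<Rightarrow> 'w \<Rightarrow> 'b) \<Rightarrow> real \<Rightarrow> 'a \<Rightarrow> real \<Rightarrow> 'w \<Rightarrow> 'a" where
  "Xt f Y \<epsilon> x t \<omega> = Xd f Y \<epsilon> x (nat \<lfloor>t / \<epsilon>\<rfloor>) \<omega>"

definition fbar :: "('a::euclidean_space \<Rightarrow> 'b \<Rightarrow> 'a) \<Rightarrow> 'b measure \<Rightarrow> 'b set \<Rightarrow> 'a \<Rightarrow> 'a" where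
  "fbar f \<mu> S x = (LINT y:S|\<mu>. f x y)"

end

theory Submission
  imports Defs
begin

text \<open>
  Almost surely the ergodic averages converge at every point of a countable dense set, hence, by the
  local Lipschitz bounds, at every \<open>z\<close> simultaneously. Along such a path, subtract the recursion from
  the ODE sampled at \<open>\<epsilon> k\<close>: the difference is driven by \<open>\<epsilon> \<Sum>j<k. f (c (\<epsilon> j)) (Y (j + 1)) - fbar (c (\<epsilon> j))\<close>,
  which is uniformly small for \<open>\<epsilon> k \<le> T\<close> because \<open>c (\<epsilon> j)\<close> varies slowly in \<open>j\<close>. A Gronwall argument that
  also keeps the recursion inside a tube around \<open>c\<close> gives uniform convergence on every \<open>{0..T}\<close>,
  which is the first claim. The second follows by dominated convergence and by letting the horizon
  \<open>T \<epsilon>\<close> be the largest \<open>N \<le> 1 / \<epsilon>\<close> for which the deviation \<open>1 / (N + 1)\<close> on \<open>{0..N}\<close> has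
  probability below \<open>1 / (N + 1)\<close>.
\<close>

section \<open>Scaled partial sums and a discrete Gronwall inequality\<close>

text \<open>Vanishing averages make the \<open>k\<close>-th partial sum \<open>o(k)\<close>. Beyond
  some index \<open>K\<close> it is at most \<open>\<eta> / T' * k\<close>, and
  \<open>\<epsilon> * k\<close> is bounded by the horizon. The finitely many earlier sums share one
  bound \<open>C\<close>, which a small \<open>\<epsilon>\<close> absorbs.\<close>

lemma scaled_partial_sums_small:
  fixes a :: "nat \<Rightarrow> 'b::real_normed_vector"
  assumes avg: "(\<lambda>N. (1 / real (N + 1)) *\<^sub>R (\<Sum>k\<le>N. a k)) \<longlonglongrightarrow> 0" and "\<eta> > 0"
  shows "\<forall>\<^sub>F \<epsilon> in at_right 0. \<forall>k. \<epsilon> * real k \<le> T \<longrightarrow> \<epsilon> * norm (\<Sum>j<k. a j) \<le> \<eta>"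
proof -
  \<comment> \<open>\<open>T\<close> may be zero or negative, and the bound divides by the
    horizon.\<close>
  define T' where "T' = max T 1"
  have T': "T' > 0" "T \<le> T'" by (auto simp: T'_def)
  have "\<eta> / T' > 0" using T' \<open>\<eta> > 0\<close> by simp
  then obtain K where K: "\<And>N. N \<ge> K \<Longrightarrow> norm ((1 / real (N + 1)) *\<^sub>R (\<Sum>k\<le>N. a k)) < \<eta> / T'"
    using LIMSEQ_D[OF avg] by fastforce
  define C where "C = (\<Sum>k\<le>K. norm (\<Sum>j<k. a j))"
  have C0: "C \<ge> 0" by (simp add: C_def sum_nonneg)
  have small: "norm (\<Sum>j<k. a j) \<le> C" if "k \<le> K" for k
    unfolding C_def using that by (intro member_le_sum) auto
  have large: "norm (\<Sum>j<k. a j) \<le> \<eta> / T' * real k" if "k > K" for k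
  proof -
    \<comment> \<open>The average indexed by \<open>N\<close> has \<open>N + 1\<close> terms, so the
      sum over \<open>j<k\<close> belongs to \<open>N = k - 1\<close>.\<close>
    define N where "N = k - 1"
    have N: "k = Suc N" "N \<ge> K" using that by (auto simp: N_def)
    have "norm (\<Sum>j<k. a j) / real k < \<eta> / T'"
      using K[OF N(2)] unfolding N(1) by (simp add: lessThan_Suc_atMost)
    then show ?thesis using N by (simp add: field_simps)
  qed
  have "\<forall>\<^sub>F \<epsilon> in at_right 0. \<epsilon> \<in> {0<..<\<eta> / (C + 1)}"
    by (rule eventually_at_right_real) (use \<open>\<eta> > 0\<close> C0 in auto)
  then show ?thesis
  proof eventually_elim
    case (elim \<epsilon>)
    show ?case
    proof (intro allI impI)
      fix k assume k: "\<epsilon> * real k \<le> T"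
      show "\<epsilon> * norm (\<Sum>j<k. a j) \<le> \<eta>"
      proof (cases "k \<le> K")
        case True
        have "\<epsilon> * norm (\<Sum>j<k. a j) \<le> \<epsilon> * (C + 1)"
          using small[OF True] elim by (intro mult_left_mono) auto
        also have "\<dots> \<le> \<eta>" using elim C0 by (auto simp: field_simps)
        finally show ?thesis .
      next
        case False
        then have "\<epsilon> * norm (\<Sum>j<k. a j) \<le> \<epsilon> * (\<eta> / T' * real k)"
          using large[of k] elim by (intro mult_left_mono) auto
        also have "\<dots> = \<eta> / T' * (\<epsilon> * real k)" by simp
        also have "\<dots> \<le> \<eta> / T' * T'"
          using k T' \<open>\<eta> > 0\<close> by (intro mult_left_mono) auto
        also have "\<dots> = \<eta>" using T' by simp
        finally show ?thesis .
      qed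
    qed
  qed
qed

text \<open>The slowly varying argument is frozen on each cell of a grid of mesh \<open>T / m\<close>; induction over
  the cells accumulates a freezing error of order \<open>(T / m)\<^sup>2\<close> per cell.\<close>

lemma scaled_partial_sums_slowly_varying_small:
  fixes h :: "nat \<Rightarrow> real \<Rightarrow> 'b::real_normed_vector"
  assumes lip: "\<And>j s t. s \<in> {0..T} \<Longrightarrow> t \<in> {0..T} \<Longrightarrow> norm (h j s - h j t) \<le> K * \<bar>s - t\<bar>"
    and avg: "\<And>s. s \<in> {0..T} \<Longrightarrow> (\<lambda>N. (1 / real (N + 1)) *\<^sub>R (\<Sum>k\<le>N. h k s)) \<longlonglongrightarrow> 0"
    and "T > 0" "\<eta> > 0"
  shows "\<forall>\<^sub>F \<epsilon> in at_right 0. \<forall>k. \<epsilon> * real k \<le> T \<longrightarrow>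
           \<epsilon> * norm (\<Sum>j<k. h j (\<epsilon> * real j)) \<le> \<eta>"
proof -
  have "norm (h 0 T - h 0 0) \<le> K * \<bar>T - 0\<bar>" using \<open>T > 0\<close> by (intro lip) auto
  then have "0 \<le> K * T" using \<open>T > 0\<close> by (smt (verit) norm_ge_zero)
  then have K0: "K \<ge> 0" using \<open>T > 0\<close> by (simp add: zero_le_mult_iff)
  \<comment> \<open>With mesh \<open>d = T / m\<close>, the \<open>m\<close> cells contribute
    \<open>m * (2 * K * d * d) = 2 * K * T * T / m\<close> in total; this choice of \<open>m\<close>
    brings it down to \<open>\<eta> / 2\<close>.\<close>
  obtain m :: nat where m: "real m > 4 * K * T * T / \<eta> + 1" using reals_Archimedean2 by blast
  have "4 * K * T * T / \<eta> \<ge> 0" using K0 \<open>T > 0\<close> \<open>\<eta> > 0\<close> by simp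
  then have m0: "real m > 0" using m by linarith
  define d where "d = T / real m"
  have d0: "d > 0" using m0 \<open>T > 0\<close> by (simp add: d_def)
  have md: "real m * d = T" using m0 by (simp add: d_def)
  \<comment> \<open>The slack \<open>\<theta>\<close> is quantified inside the induction because
    each cell spends it in thirds: one for the previous cells and two for frozen partial
    sums.\<close>
  have step: "\<forall>\<theta>>0. \<forall>\<^sub>F \<epsilon> in at_right 0. \<forall>k. \<epsilon> * real k \<le> real i * d \<longrightarrow>
      \<epsilon> * norm (\<Sum>j<k. h j (\<epsilon> * real j)) \<le> \<theta> + real i * (2 * K * d * d)" if "i \<le> m" for i
    using that
  proof (induction i)
    case 0
    show ?case
    proof (intro allI impI)
      fix \<theta> :: real assume "\<theta> > 0"
      have "\<forall>\<^sub>F \<epsilon> :: real in at_right 0. \<epsilon> > 0" by (simp add: eventually_at_right_less)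
      then show "\<forall>\<^sub>F \<epsilon> in at_right 0. \<forall>k. \<epsilon> * real k \<le> real 0 * d \<longrightarrow>
        \<epsilon> * norm (\<Sum>j<k. h j (\<epsilon> * real j)) \<le> \<theta> + real 0 * (2 * K * d * d)"
        by eventually_elim (use \<open>\<theta> > 0\<close> in \<open>auto simp: mult_le_0_iff\<close>)
    qed
  next
    case (Suc i)
    define s where "s = real i * d"
    have sT: "s + d \<le> T"
    proof -
      have "(real i + 1) * d \<le> real m * d" using Suc.prems d0 by (intro mult_right_mono) auto
      then show ?thesis unfolding md by (simp add: s_def algebra_simps)
    qed
    have s0: "s \<ge> 0" using d0 by (simp add: s_def)
    show ?case
    proof (intro allI impI)
      fix \<theta> :: real assume "\<theta> > 0"
      then have \<theta>3: "\<theta> / 3 > 0" by simp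
      have IH: "\<forall>\<^sub>F \<epsilon> in at_right 0. \<forall>k. \<epsilon> * real k \<le> s \<longrightarrow>
          \<epsilon> * norm (\<Sum>j<k. h j (\<epsilon> * real j)) \<le> \<theta> / 3 + real i * (2 * K * d * d)"
        using Suc \<theta>3 unfolding s_def by simp
      have frozen: "\<forall>\<^sub>F \<epsilon> in at_right 0. \<forall>k. \<epsilon> * real k \<le> T \<longrightarrow>
          \<epsilon> * norm (\<Sum>j<k. h j s) \<le> \<theta> / 3"
        using avg[of s] s0 sT d0 \<theta>3 by (intro scaled_partial_sums_small) auto
      have "\<forall>\<^sub>F \<epsilon> in at_right 0. \<epsilon> \<in> {0<..<d}" by (rule eventually_at_right_real[OF d0])
      with IH frozen show "\<forall>\<^sub>F \<epsilon> in at_right 0. \<forall>k. \<epsilon> * real k \<le> real (Suc i) * d \<longrightarrow>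
        \<epsilon> * norm (\<Sum>j<k. h j (\<epsilon> * real j)) \<le> \<theta> + real (Suc i) * (2 * K * d * d)"
      proof eventually_elim
        case (elim \<epsilon>)
        then have \<epsilon>: "\<epsilon> > 0" "\<epsilon> < d" by auto
        have Kdd: "K * d * d \<ge> 0" using K0 d0 by simp
        show ?case
        proof (intro allI impI)
          fix k assume k: "\<epsilon> * real k \<le> real (Suc i) * d"
          have ksd: "\<epsilon> * real k \<le> s + d" using k by (simp add: s_def algebra_simps)
          show "\<epsilon> * norm (\<Sum>j<k. h j (\<epsilon> * real j)) \<le> \<theta> + real (Suc i) * (2 * K * d * d)"
          proof (cases "\<epsilon> * real k \<le> s")
            case True
            then have "\<epsilon> * norm (\<Sum>j<k. h j (\<epsilon> * real j)) \<le> \<theta> / 3 + real i * (2 * K * d * d)"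
              using elim by blast
            then show ?thesis using Kdd \<open>\<theta> > 0\<close> by (simp add: algebra_simps)
          next
            case False
            \<comment> \<open>The last index whose time does not exceed \<open>s\<close>. Since
              \<open>\<epsilon> * a\<close> may precede \<open>s\<close> by almost
              \<open>\<epsilon>\<close>, the block \<open>{a..<k}\<close> covers a time span of up
              to \<open>d + \<epsilon>\<close>, hence the factor 2 in the error per cell.\<close>
            define a where "a = nat \<lfloor>s / \<epsilon>\<rfloor>"
            have a_le: "real a \<le> s / \<epsilon>" unfolding a_def using s0 \<epsilon> by simp
            then have as: "\<epsilon> * real a \<le> s" using \<epsilon> by (simp add: field_simps)
            have "s / \<epsilon> < real a + 1" unfolding a_def using s0 \<epsilon> by linarith
            then have sa: "s < \<epsilon> * real a + \<epsilon>" using \<epsilon> by (simp add: field_simps)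
            have "\<epsilon> * real a < \<epsilon> * real k" using as False by linarith
            then have ak: "a < k" using \<epsilon> by simp
            have err: "norm (h j (\<epsilon> * real j) - h j s) \<le> K * d" if "j \<in> {a..<k}" for j
            proof -
              have j: "\<epsilon> * real a \<le> \<epsilon> * real j" "\<epsilon> * real j \<le> \<epsilon> * real k"
                using that \<epsilon> by auto
              have "0 \<le> \<epsilon> * real j" using \<epsilon> by simp
              then have "norm (h j (\<epsilon> * real j) - h j s) \<le> K * \<bar>\<epsilon> * real j - s\<bar>"
                using j ksd sT s0 d0 by (intro lip) auto
              also have "\<dots> \<le> K * d"
                using K0 by (rule mult_left_mono[rotated]) (use j ksd sa \<epsilon> in linarith)
              finally show ?thesis .
            qed
            have split: "(\<Sum>j<k. g j) = (\<Sum>j<a. g j) + (\<Sum>j\<in>{a..<k}. g j)" for g :: "nat \<Rightarrow> 'b"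
              using ak by (metis atLeast0LessThan le_eq_less_or_eq sum.atLeastLessThan_concat zero_le)
            have dec: "(\<Sum>j<k. h j (\<epsilon> * real j)) = (\<Sum>j<a. h j (\<epsilon> * real j)) +
               (\<Sum>j\<in>{a..<k}. h j (\<epsilon> * real j) - h j s) + (\<Sum>j<k. h j s) - (\<Sum>j<a. h j s)"
              unfolding split[of "\<lambda>j. h j (\<epsilon> * real j)"] split[of "\<lambda>j. h j s"]
              by (simp add: sum_subtractf)
            have "norm (\<Sum>j\<in>{a..<k}. h j (\<epsilon> * real j) - h j s) \<le> real (card {a..<k}) * (K * d)"
              using err by (intro sum_norm_bound)
            also have "\<dots> = (real k - real a) * (K * d)" using ak by (simp add: of_nat_diff)
            finally have "\<epsilon> * norm (\<Sum>j\<in>{a..<k}. h j (\<epsilon> * real j) - h j s)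
                \<le> \<epsilon> * ((real k - real a) * (K * d))" using \<epsilon> by (intro mult_left_mono) auto
            also have "\<dots> = (\<epsilon> * real k - \<epsilon> * real a) * (K * d)" by (simp add: algebra_simps)
            also have "\<dots> \<le> (2 * d) * (K * d)"
              using ksd sa \<epsilon> K0 d0 by (intro mult_right_mono) auto
            finally have e1: "\<epsilon> * norm (\<Sum>j\<in>{a..<k}. h j (\<epsilon> * real j) - h j s) \<le> 2 * K * d * d"
              by (simp add: algebra_simps)
            have e2: "\<epsilon> * norm (\<Sum>j<a. h j (\<epsilon> * real j)) \<le> \<theta> / 3 + real i * (2 * K * d * d)"
              using elim as by blast
            have e3: "\<epsilon> * norm (\<Sum>j<k. h j s) \<le> \<theta> / 3" "\<epsilon> * norm (\<Sum>j<a. h j s) \<le> \<theta> / 3"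
              using elim as ksd sT d0 by (auto intro: order_trans)
            have "norm (\<Sum>j<k. h j (\<epsilon> * real j)) \<le> norm (\<Sum>j<a. h j (\<epsilon> * real j)) +
               norm (\<Sum>j\<in>{a..<k}. h j (\<epsilon> * real j) - h j s) + norm (\<Sum>j<k. h j s)
               + norm (\<Sum>j<a. h j s)"
              unfolding dec by (intro norm_triangle_le norm_triangle_le_diff add_mono order_refl)
            then have "\<epsilon> * norm (\<Sum>j<k. h j (\<epsilon> * real j)) \<le> \<epsilon> * (norm (\<Sum>j<a. h j (\<epsilon> * real j)) +
               norm (\<Sum>j\<in>{a..<k}. h j (\<epsilon> * real j) - h j s) + norm (\<Sum>j<k. h j s)
               + norm (\<Sum>j<a. h j s))" using \<epsilon> by (intro mult_left_mono) auto
            then show ?thesis using e1 e2 e3 by (simp add: algebra_simps)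
          qed
        qed
      qed
    qed
  qed
  have "real m * (2 * K * d * d) \<le> \<eta> / 2"
  proof -
    have "4 * K * T * T / \<eta> \<le> real m" using m by simp
    then have "4 * K * T * T \<le> real m * \<eta>" using \<open>\<eta> > 0\<close> by (simp add: field_simps)
    moreover have "real m * (2 * K * d * d) = 2 * K * T * T / real m"
      using m0 by (simp add: d_def field_simps)
    moreover have "2 * K * T * T / real m \<le> \<eta> / 2"
      using calculation(1) m0 by (simp add: field_simps)
    ultimately show ?thesis by linarith
  qed
  moreover have "\<forall>\<^sub>F \<epsilon> in at_right 0. \<forall>k. \<epsilon> * real k \<le> T \<longrightarrow>
      \<epsilon> * norm (\<Sum>j<k. h j (\<epsilon> * real j)) \<le> \<eta> / 2 + real m * (2 * K * d * d)"
    using step[of m] \<open>\<eta> > 0\<close> by (simp add: md)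
  ultimately show ?thesis by (auto elim!: eventually_mono)
qed

text \<open>The inequality for \<open>e k\<close> is only required while the earlier errors stay below \<open>\<rho>\<close>: this is
  what confines a locally Lipschitz recursion to the tube on which its constant is valid.\<close>

lemma discrete_gronwall_confined:
  fixes e :: "nat \<Rightarrow> real"
  assumes rec: "\<And>k. k \<le> n \<Longrightarrow> (\<And>j. j < k \<Longrightarrow> e j \<le> \<rho>) \<Longrightarrow> e k \<le> \<eta> + a * (\<Sum>j<k. e j)"
    and bound: "\<eta> * (1 + a) ^ n \<le> \<rho>" and "a \<ge> 0" "\<eta> \<ge> 0" "k \<le> n"
  shows "e k \<le> \<eta> * (1 + a) ^ k"
  using \<open>k \<le> n\<close>
proof (induction k rule: less_induct)
  case (less k)
  \<comment> \<open>By this identity \<open>\<eta> * (1 + a) ^ k\<close> solves the recursion with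
    equality, so the induction reproduces it exactly.\<close>
  have geo: "a * (\<Sum>j<k. (1 + a) ^ j) = (1 + a) ^ k - 1"
    using power_diff_1_eq[of "1 + a" k] by simp
  have le: "e j \<le> \<eta> * (1 + a) ^ j" if "j < k" for j using less that by simp
  have "e j \<le> \<rho>" if "j < k" for j
  proof -
    have "\<eta> * (1 + a) ^ j \<le> \<eta> * (1 + a) ^ n"
      using that less.prems assms by (intro mult_left_mono power_increasing) auto
    then show ?thesis using le[OF that] bound by linarith
  qed
  then have "e k \<le> \<eta> + a * (\<Sum>j<k. e j)" using rec less.prems by blast
  also have "\<dots> \<le> \<eta> + a * (\<Sum>j<k. \<eta> * (1 + a) ^ j)"
    using le \<open>a \<ge> 0\<close> by (intro add_left_mono mult_left_mono sum_mono) auto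
  also have "\<dots> = \<eta> + \<eta> * (a * (\<Sum>j<k. (1 + a) ^ j))" by (simp add: sum_distrib_left mult_ac)
  also have "\<dots> = \<eta> * (1 + a) ^ k" unfolding geo by (simp add: algebra_simps)
  finally show ?case .
qed

section \<open>Averages and Lipschitz dependence on the state\<close>

lemma norm_averages_diff_le:
  fixes a b :: "nat \<Rightarrow> 'b::real_normed_vector"
  assumes "\<And>k. norm (a k - b k) \<le> C"
  shows "norm ((1 / real (N + 1)) *\<^sub>R (\<Sum>k\<le>N. a k) - (1 / real (N + 1)) *\<^sub>R (\<Sum>k\<le>N. b k)) \<le> C"
proof -
  have "norm (\<Sum>k\<le>N. a k - b k) \<le> real (card {..N}) * C" using assms by (intro sum_norm_bound)
  then have "(1 / real (N + 1)) * norm (\<Sum>k\<le>N. a k - b k) \<le> C" by (simp add: field_simps)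
  moreover have "(1 / real (N + 1)) *\<^sub>R (\<Sum>k\<le>N. a k) - (1 / real (N + 1)) *\<^sub>R (\<Sum>k\<le>N. b k)
      = (1 / real (N + 1)) *\<^sub>R (\<Sum>k\<le>N. a k - b k)"
    by (simp add: sum_subtractf scaleR_diff_right)
  ultimately show ?thesis by simp
qed

text \<open>This passes Lipschitz bounds from the summands to the averaged field with the same
  constant.\<close>

lemma norm_average_limits_diff_le:
  fixes a b :: "nat \<Rightarrow> 'b::real_normed_vector"
  assumes a: "(\<lambda>N. (1 / real (N + 1)) *\<^sub>R (\<Sum>k\<le>N. a k)) \<longlonglongrightarrow> A"
    and b: "(\<lambda>N. (1 / real (N + 1)) *\<^sub>R (\<Sum>k\<le>N. b k)) \<longlonglongrightarrow> B"
    and le: "\<And>k. norm (a k - b k) \<le> C"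
  shows "norm (A - B) \<le> C"
  by (rule Lim_norm_ubound[OF _ tendsto_diff[OF a b]])
     (use norm_averages_diff_le[OF le] in \<open>auto intro!: always_eventually\<close>)

text \<open>A three-epsilon argument: the averages at \<open>z\<close> and at a nearby
  \<open>q\<close> in \<open>Q\<close> differ by at most \<open>L * norm (z - q)\<close> for every
  \<open>N\<close>, and so do their candidate limits.\<close>

lemma averages_tendsto_of_dense:
  fixes F :: "nat \<Rightarrow> 'a::euclidean_space \<Rightarrow> 'b::real_normed_vector"
  assumes lip: "\<And>D. compact D \<Longrightarrow> \<exists>L. \<forall>u\<in>D. \<forall>v\<in>D.
      (\<forall>k. norm (F k u - F k v) \<le> L * norm (u - v)) \<and> norm (G u - G v) \<le> L * norm (u - v)"
    and dense: "closure Q = UNIV"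
    and avg: "\<And>q. q \<in> Q \<Longrightarrow> (\<lambda>N. (1 / real (N + 1)) *\<^sub>R (\<Sum>k\<le>N. F k q)) \<longlonglongrightarrow> G q"
  shows "(\<lambda>N. (1 / real (N + 1)) *\<^sub>R (\<Sum>k\<le>N. F k z)) \<longlonglongrightarrow> G z"
proof (rule LIMSEQ_I)
  fix r :: real assume "r > 0"
  obtain L where L: "\<And>k u v. u \<in> cball z 1 \<Longrightarrow> v \<in> cball z 1 \<Longrightarrow> norm (F k u - F k v) \<le> L * norm (u - v)"
      "\<And>u v. u \<in> cball z 1 \<Longrightarrow> v \<in> cball z 1 \<Longrightarrow> norm (G u - G v) \<le> L * norm (u - v)"
    using lip[of "cball z 1"] by (auto simp del: mem_cball)
  \<comment> \<open>The cap 1 keeps \<open>q\<close> in the ball on which \<open>L\<close> is valid;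
    \<open>\<bar>L\<bar> + 1\<close> is positive whatever the sign of \<open>L\<close>.\<close>
  define \<theta> where "\<theta> = min 1 (r / (3 * (\<bar>L\<bar> + 1)))"
  have "\<theta> > 0" using \<open>r > 0\<close> by (simp add: \<theta>_def)
  then obtain q where q: "q \<in> Q" "dist q z < \<theta>"
    using dense closure_approachable[of z Q] by auto
  then have q1: "q \<in> cball z 1" "z \<in> cball z 1" by (auto simp: \<theta>_def dist_commute)
  have "L * norm (z - q) \<le> (\<bar>L\<bar> + 1) * \<theta>"
    using q by (intro mult_mono) (auto simp: dist_norm norm_minus_commute)
  also have "\<dots> \<le> (\<bar>L\<bar> + 1) * (r / (3 * (\<bar>L\<bar> + 1)))"
    by (intro mult_left_mono) (auto simp: \<theta>_def)
  also have "\<dots> = r / 3" using abs_ge_zero[of L] by (simp add: field_simps)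
  finally have Lq: "L * norm (z - q) \<le> r / 3" .
  obtain N0 where N0: "\<And>N. N \<ge> N0 \<Longrightarrow> norm ((1 / real (N + 1)) *\<^sub>R (\<Sum>k\<le>N. F k q) - G q) < r / 3"
    using LIMSEQ_D[OF avg[OF q(1)], of "r / 3"] \<open>r > 0\<close> by auto
  show "\<exists>N0. \<forall>N\<ge>N0. norm ((1 / real (N + 1)) *\<^sub>R (\<Sum>k\<le>N. F k z) - G z) < r"
  proof (intro exI allI impI)
    fix N assume "N \<ge> N0"
    define Az Aq where "Az = (1 / real (N + 1)) *\<^sub>R (\<Sum>k\<le>N. F k z)"
      and "Aq = (1 / real (N + 1)) *\<^sub>R (\<Sum>k\<le>N. F k q)"
    have "norm (Az - Aq) \<le> r / 3"
      unfolding Az_def Aq_def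
      using order_trans[OF L(1)[OF q1(2,1)] Lq] by (intro norm_averages_diff_le)
    moreover have "norm (Aq - G q) < r / 3" unfolding Aq_def using N0[OF \<open>N \<ge> N0\<close>] .
    moreover have "norm (G q - G z) \<le> r / 3"
      using order_trans[OF L(2)[OF q1(2,1)] Lq] by (simp add: norm_minus_commute)
    moreover have "norm (Az - G z) \<le> norm (Az - Aq) + norm (Aq - G q) + norm (G q - G z)"
      by norm
    ultimately have "norm (Az - G z) < r" by linarith
    then show "norm ((1 / real (N + 1)) *\<^sub>R (\<Sum>k\<le>N. F k z) - G z) < r" by (simp add: Az_def)
  qed
qed

section \<open>Averaging along a fixed path\<close>

text \<open>The tube of radius 1 around \<open>c\<close> on \<open>{0..T}\<close> is bounded, so one
  constant \<open>L\<close> serves \<open>F\<close> and \<open>G\<close> there. The error at grid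
  times is Lipschitz feedback plus two forcing terms, the averaged fluctuation and the Euler
  consistency error. Each forcing term is at most \<open>\<eta>\<close> for small
  \<open>\<epsilon>\<close>, and Gronwall amplifies their sum by at most
  \<open>exp (L * T)\<close>.\<close>

lemma averaging_pathwise:
  fixes F :: "nat \<Rightarrow> 'a::euclidean_space \<Rightarrow> 'a" and X :: "real \<Rightarrow> nat \<Rightarrow> 'a"
  assumes lip: "\<And>D. compact D \<Longrightarrow> \<exists>L. \<forall>k. \<forall>u\<in>D. \<forall>v\<in>D. norm (F k u - F k v) \<le> L * norm (u - v)"
    and avg: "\<And>z. (\<lambda>N. (1 / real (N + 1)) *\<^sub>R (\<Sum>k\<le>N. F k z)) \<longlonglongrightarrow> G z"
    and X0: "\<And>\<epsilon>. X \<epsilon> 0 = c 0"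
    and XS: "\<And>\<epsilon> k. X \<epsilon> (Suc k) = X \<epsilon> k + \<epsilon> *\<^sub>R F k (X \<epsilon> k)"
    and ode: "\<And>t. t \<ge> 0 \<Longrightarrow> (c has_vector_derivative G (c t)) (at t within {0..})"
    and "T > 0" "\<delta> > 0"
  shows "\<forall>\<^sub>F \<epsilon> in at_right 0. \<forall>t\<in>{0..T}. norm (X \<epsilon> (nat \<lfloor>t / \<epsilon>\<rfloor>) - c t) \<le> \<delta>"
proof -
  have "continuous_on {0..} c"
    using ode by (auto intro!: has_vector_derivative_continuous simp: continuous_on_eq_continuous_within)
  then have "continuous_on {0..T} c" by (rule continuous_on_subset) auto
  then have "bounded (c ` {0..T})" by (intro compact_imp_bounded compact_continuous_image) auto
  then obtain R where R: "\<And>t. t \<in> {0..T} \<Longrightarrow> norm (c t) \<le> R" by (force simp: bounded_iff)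
  define D where "D = cball (0::'a) (R + 1)"
  have cD: "c t \<in> D" if "t \<in> {0..T}" for t using R[OF that] by (simp add: D_def)
  have tube: "u \<in> D" if "norm (u - c t) \<le> 1" "t \<in> {0..T}" for u t
    using R[OF that(2)] that(1) norm_triangle_sub[of u "c t"] by (simp add: D_def)
  obtain L' where L': "\<And>k u v. u \<in> D \<Longrightarrow> v \<in> D \<Longrightarrow> norm (F k u - F k v) \<le> L' * norm (u - v)"
    using lip[of D] compact_cball unfolding D_def by blast
  define L where "L = max L' 0"
  have L0: "L \<ge> 0" by (simp add: L_def)
  have FL: "norm (F k u - F k v) \<le> L * norm (u - v)" if "u \<in> D" "v \<in> D" for k u v
    using L'[OF that, of k] mult_right_mono[of L' L "norm (u - v)"] by (simp add: L_def)
  have GL: "norm (G u - G v) \<le> L * norm (u - v)" if "u \<in> D" "v \<in> D" for u v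
    using norm_average_limits_diff_le[OF avg avg FL[OF that]] .
  have "\<exists>C. \<forall>t\<in>{0..T}. norm (G (c t)) \<le> C"
  proof (intro exI ballI)
    fix t assume t: "t \<in> {0..T}"
    have 0: "0 \<in> {0..T}" using \<open>T > 0\<close> by simp
    have "norm (G (c t)) \<le> norm (G (c 0)) + norm (G (c t) - G (c 0))" by (rule norm_triangle_sub)
    also have "norm (G (c t) - G (c 0)) \<le> L * norm (c t - c 0)" using cD t 0 by (intro GL)
    also have "\<dots> \<le> L * (R + R)"
      using R[OF t] R[OF 0] L0 by (intro mult_left_mono norm_triangle_le_diff add_mono) auto
    finally show "norm (G (c t)) \<le> norm (G (c 0)) + L * (R + R)" by simp
  qed
  then obtain C' where C': "\<And>t. t \<in> {0..T} \<Longrightarrow> norm (G (c t)) \<le> C'" by blast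
  \<comment> \<open>Linearizing \<open>c\<close> at \<open>s\<close> costs twice the bound on the
    velocity for the remainder, and the linear term costs it once more.\<close>
  define C where "C = 3 * max C' 0"
  have C0: "C \<ge> 0" by (simp add: C_def)
  have ode': "(c has_vector_derivative G (c t)) (at t within S)" if "S \<subseteq> {0..}" "t \<in> S" for S t
    using ode[of t] that by (auto intro: has_vector_derivative_within_subset)
  have clip: "norm (c t - c s) \<le> C * \<bar>t - s\<bar>" if "s \<in> {0..T}" "t \<in> {0..T}" for s t
  proof -
    have "norm (c t - c s - (t - s) *\<^sub>R G (c s)) \<le> norm (t - s) * (2 * max C' 0)"
    proof (rule vector_differentiable_bound_linearization[where S = "{0..T}"])
      show "closed_segment s t \<subseteq> {0..T}" using that by (auto simp: closed_segment_eq_real_ivl)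
      show "norm (G (c u) - G (c s)) \<le> 2 * max C' 0" if "u \<in> {0..T}" for u
        using C'[OF that] C'[OF \<open>s \<in> _\<close>] norm_triangle_ineq4[of "G (c u)" "G (c s)"] by linarith
    qed (use that ode' in auto)
    moreover have "norm ((t - s) *\<^sub>R G (c s)) \<le> \<bar>t - s\<bar> * max C' 0"
      using C'[OF that(1)] by (simp add: mult_left_mono)
    moreover have "norm (c t - c s) \<le> norm (c t - c s - (t - s) *\<^sub>R G (c s)) + norm ((t - s) *\<^sub>R G (c s))"
      using norm_triangle_sub[of "c t - c s" "(t - s) *\<^sub>R G (c s)"] by linarith
    ultimately show ?thesis by (simp add: C_def algebra_simps)
  qed
  define K where "K = L * C"
  have K0: "K \<ge> 0" using L0 C0 by (simp add: K_def)
  have FK: "norm (F j (c s) - F j (c t)) \<le> K * \<bar>s - t\<bar>" if "s \<in> {0..T}" "t \<in> {0..T}" for j s t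
    using FL[OF cD[OF that(1)] cD[OF that(2)], of j] mult_left_mono[OF clip[OF that(2,1)] L0]
    by (simp add: K_def)
  have GK: "norm (G (c s) - G (c t)) \<le> K * \<bar>s - t\<bar>" if "s \<in> {0..T}" "t \<in> {0..T}" for s t
    using GL[OF cD[OF that(1)] cD[OF that(2)]] mult_left_mono[OF clip[OF that(2,1)] L0]
    by (simp add: K_def)
  \<comment> \<open>One Euler step along \<open>c\<close> has a second-order error because
    \<open>G\<close> varies by at most \<open>K * \<epsilon>\<close> along it. Summed over all steps
    up to \<open>T\<close> this gives at most \<open>T * K * \<epsilon>\<close>.\<close>
  have local_error: "norm (c (\<epsilon> * real (Suc j)) - c (\<epsilon> * real j) - \<epsilon> *\<^sub>R G (c (\<epsilon> * real j))) \<le> \<epsilon> * (K * \<epsilon>)"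
    if \<epsilon>: "\<epsilon> > 0" and j: "\<epsilon> * real (Suc j) \<le> T" for \<epsilon> j
  proof -
    define s where "s = \<epsilon> * real j"
    have s: "s \<ge> 0" "\<epsilon> * real (Suc j) = s + \<epsilon>" using \<epsilon> by (auto simp: s_def algebra_simps)
    have "norm (c (s + \<epsilon>) - c s - (s + \<epsilon> - s) *\<^sub>R G (c s)) \<le> norm (s + \<epsilon> - s) * (K * \<epsilon>)"
    proof (rule vector_differentiable_bound_linearization[where S = "{s..s + \<epsilon>}"])
      show "closed_segment s (s + \<epsilon>) \<subseteq> {s..s + \<epsilon>}" using \<epsilon> by (auto simp: closed_segment_eq_real_ivl)
      show "norm (G (c u) - G (c s)) \<le> K * \<epsilon>" if "u \<in> {s..s + \<epsilon>}" for u
      proof -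
        have "norm (G (c u) - G (c s)) \<le> K * \<bar>u - s\<bar>" using that j s by (intro GK) auto
        also have "\<dots> \<le> K * \<epsilon>" using that K0 by (intro mult_left_mono) auto
        finally show ?thesis .
      qed
      show "(c has_vector_derivative G (c u)) (at u within {s..s + \<epsilon>})" if "u \<in> {s..s + \<epsilon>}" for u
        using that s by (intro ode') auto
    qed (use \<epsilon> in auto)
    then show ?thesis using \<epsilon> s by (simp add: s_def)
  qed
  \<comment> \<open>\<open>\<rho>\<close> stays below 1 to remain in the tube, and below
    \<open>\<delta> / 2\<close> to leave room for the motion of \<open>c\<close> between grid times.
    The factor 2 in \<open>\<eta>\<close> accounts for the two forcing terms.\<close>
  define \<rho> where "\<rho> = min (\<delta> / 2) 1"
  define \<eta> where "\<eta> = \<rho> / (2 * exp (L * T))"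
  have \<rho>0: "\<rho> > 0" "\<rho> \<le> 1" "\<rho> \<le> \<delta> / 2" using \<open>\<delta> > 0\<close> by (auto simp: \<rho>_def)
  then have \<eta>0: "\<eta> > 0" by (simp add: \<eta>_def)
  have \<rho>\<eta>: "2 * \<eta> * exp (L * T) = \<rho>" by (simp add: \<eta>_def)
  define h where "h = (\<lambda>j t. F j (c t) - G (c t))"
  have fluct: "\<forall>\<^sub>F \<epsilon> in at_right 0. \<forall>k. \<epsilon> * real k \<le> T \<longrightarrow>
      \<epsilon> * norm (\<Sum>j<k. h j (\<epsilon> * real j)) \<le> \<eta>"
  proof (rule scaled_partial_sums_slowly_varying_small[where K = "2 * K"])
    show "norm (h j s - h j t) \<le> 2 * K * \<bar>s - t\<bar>" if "s \<in> {0..T}" "t \<in> {0..T}" for j s t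
    proof -
      have "h j s - h j t = (F j (c s) - F j (c t)) - (G (c s) - G (c t))" by (simp add: h_def)
      then show ?thesis
        using FK[OF that, of j] GK[OF that]
          norm_triangle_ineq4[of "F j (c s) - F j (c t)" "G (c s) - G (c t)"] by simp
    qed
    show "(\<lambda>N. (1 / real (N + 1)) *\<^sub>R (\<Sum>k\<le>N. h k s)) \<longlonglongrightarrow> 0" for s
    proof -
      have eq: "(1 / real (N + 1)) *\<^sub>R (\<Sum>k\<le>N. h k s)
          = (1 / real (N + 1)) *\<^sub>R (\<Sum>k\<le>N. F k (c s)) - G (c s)" for N
        by (simp add: h_def sum_subtractf scaleR_diff_right sum_constant_scaleR)
      show ?thesis unfolding eq using avg[of "c s"] by (simp add: LIM_zero)
    qed
  qed (use \<open>T > 0\<close> \<eta>0 in auto)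
  \<comment> \<open>The first threshold makes the accumulated Euler error at most
    \<open>\<eta>\<close>; the second makes the motion of \<open>c\<close> within one time step at
    most \<open>\<delta> / 2\<close>.\<close>
  have "\<forall>\<^sub>F \<epsilon> in at_right 0. \<epsilon> \<in> {0<..<min (\<eta> / (T * K + 1)) (\<delta> / (2 * (C + 1)))}"
    using \<open>T > 0\<close> K0 C0 \<eta>0 \<open>\<delta> > 0\<close>
    by (intro eventually_at_right_real) (auto intro!: divide_pos_pos add_nonneg_pos)
  with fluct show ?thesis
  proof eventually_elim
    case (elim \<epsilon>)
    then have \<epsilon>: "\<epsilon> > 0" and "\<epsilon> < \<eta> / (T * K + 1)" "\<epsilon> < \<delta> / (2 * (C + 1))" by auto
    moreover have "T * K + 1 > 0" using \<open>T > 0\<close> K0 by (simp add: add_nonneg_pos)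
    ultimately have \<epsilon>TK: "\<epsilon> * (T * K) \<le> \<eta>" and \<epsilon>C: "C * \<epsilon> \<le> \<delta> / 2"
      using C0 by (auto simp: field_simps)
    define e where "e k = norm (X \<epsilon> k - c (\<epsilon> * real k))" for k
    \<comment> \<open>The increments of \<open>c\<close> in the last sum telescope, and its
      \<open>G\<close> terms cancel those hidden in \<open>h\<close>. What remains is the recursion
      for \<open>X\<close> started at \<open>c 0\<close>.\<close>
    have dec: "X \<epsilon> k - c (\<epsilon> * real k) =
       (\<Sum>j<k. \<epsilon> *\<^sub>R (F j (X \<epsilon> j) - F j (c (\<epsilon> * real j)))) + \<epsilon> *\<^sub>R (\<Sum>j<k. h j (\<epsilon> * real j))
       - (\<Sum>j<k. c (\<epsilon> * real (Suc j)) - c (\<epsilon> * real j) - \<epsilon> *\<^sub>R G (c (\<epsilon> * real j)))" for k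
      by (induction k) (simp_all add: X0 XS h_def algebra_simps)
    define n where "n = nat \<lfloor>T / \<epsilon>\<rfloor>"
    have nT: "\<epsilon> * real k \<le> T" if "k \<le> n" for k
    proof -
      have "real k \<le> real n" using that by simp
      also have "\<dots> \<le> T / \<epsilon>" unfolding n_def using \<open>T > 0\<close> \<epsilon> by simp
      finally show ?thesis using \<epsilon> by (simp add: field_simps)
    qed
    have powexp: "(1 + \<epsilon> * L) ^ k \<le> exp (L * T)" if "k \<le> n" for k
    proof -
      have "(1 + \<epsilon> * L) ^ k \<le> exp (\<epsilon> * L) ^ k"
        using \<epsilon> L0 by (intro power_mono) auto
      also have "\<dots> = exp (L * (\<epsilon> * real k))" by (simp add: exp_of_nat_mult[symmetric] mult_ac)
      also have "\<dots> \<le> exp (L * T)" using nT[OF that] L0 by (simp add: mult_left_mono)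
      finally show ?thesis .
    qed
    have e_le: "e k \<le> 2 * \<eta> * (1 + \<epsilon> * L) ^ k" if "k \<le> n" for k
    \<comment> \<open>The confinement radius is 1: earlier errors of at most 1 keep
      \<open>X \<epsilon> j\<close> in \<open>D\<close>, where \<open>FL\<close> applies.\<close>
    proof (rule discrete_gronwall_confined[OF _ _ _ _ that])
      fix k assume k: "k \<le> n" and conf: "\<And>j. j < k \<Longrightarrow> e j \<le> 1"
      have "norm (\<epsilon> *\<^sub>R (F j (X \<epsilon> j) - F j (c (\<epsilon> * real j)))) \<le> \<epsilon> * L * e j" if "j < k" for j
      proof -
        have "\<epsilon> * real j \<in> {0..T}" using nT[of j] that k \<epsilon> by simp
        then have "norm (F j (X \<epsilon> j) - F j (c (\<epsilon> * real j))) \<le> L * e j"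
          unfolding e_def using conf[OF that] tube cD by (intro FL) (auto simp: e_def)
        then show ?thesis using \<epsilon> by simp
      qed
      then have "norm (\<Sum>j<k. \<epsilon> *\<^sub>R (F j (X \<epsilon> j) - F j (c (\<epsilon> * real j)))) \<le> (\<Sum>j<k. \<epsilon> * L * e j)"
        by (intro sum_norm_le) auto
      then have 1: "norm (\<Sum>j<k. \<epsilon> *\<^sub>R (F j (X \<epsilon> j) - F j (c (\<epsilon> * real j)))) \<le> \<epsilon> * L * (\<Sum>j<k. e j)"
        by (simp add: sum_distrib_left)
      have 2: "norm (\<epsilon> *\<^sub>R (\<Sum>j<k. h j (\<epsilon> * real j))) \<le> \<eta>" using elim nT[OF k] \<epsilon> by simp
      have "norm (\<Sum>j<k. c (\<epsilon> * real (Suc j)) - c (\<epsilon> * real j) - \<epsilon> *\<^sub>R G (c (\<epsilon> * real j)))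
          \<le> real (card {..<k}) * (\<epsilon> * (K * \<epsilon>))"
        using nT k by (intro sum_norm_bound local_error[OF \<epsilon>]) (auto simp del: of_nat_Suc)
      also have "\<dots> = (\<epsilon> * real k) * (K * \<epsilon>)" by simp
      also have "\<dots> \<le> T * (K * \<epsilon>)" using nT[OF k] K0 \<epsilon> by (intro mult_right_mono) auto
      also have "\<dots> \<le> \<eta>" using \<epsilon>TK by (simp add: mult_ac)
      finally have 3: "norm (\<Sum>j<k. c (\<epsilon> * real (Suc j)) - c (\<epsilon> * real j) - \<epsilon> *\<^sub>R G (c (\<epsilon> * real j))) \<le> \<eta>" .
      have "e k \<le> \<epsilon> * L * (\<Sum>j<k. e j) + \<eta> + \<eta>"
        unfolding e_def[of k] dec[of k] using 1 2 3
        by (intro norm_triangle_le norm_triangle_le_diff add_mono)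
      then show "e k \<le> 2 * \<eta> + \<epsilon> * L * (\<Sum>j<k. e j)" by simp
    next
      have "2 * \<eta> * (1 + \<epsilon> * L) ^ n \<le> 2 * \<eta> * exp (L * T)"
        using powexp[of n] \<eta>0 by (intro mult_left_mono) auto
      then show "2 * \<eta> * (1 + \<epsilon> * L) ^ n \<le> 1" using \<rho>\<eta> \<rho>0 by linarith
    qed (use \<epsilon> L0 \<eta>0 in auto)
    show ?case
    proof
      fix t assume t: "t \<in> {0..T}"
      define k where "k = nat \<lfloor>t / \<epsilon>\<rfloor>"
      have kn: "k \<le> n" unfolding k_def n_def
        using t \<epsilon> by (intro nat_mono floor_mono divide_right_mono) auto
      have "real k \<le> t / \<epsilon>" "t / \<epsilon> < real k + 1" unfolding k_def using t \<epsilon> by auto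
      then have kt: "\<epsilon> * real k \<le> t" "t < \<epsilon> * real k + \<epsilon>" using \<epsilon> by (auto simp: field_simps)
      have "e k \<le> 2 * \<eta> * exp (L * T)"
        using e_le[OF kn] mult_left_mono[OF powexp[OF kn], of "2 * \<eta>"] \<eta>0 by linarith
      then have 1: "e k \<le> \<delta> / 2" using \<rho>\<eta> \<rho>0 by linarith
      have "norm (c (\<epsilon> * real k) - c t) \<le> C * \<bar>\<epsilon> * real k - t\<bar>"
        using t kt nT[OF kn] \<epsilon> by (intro clip) auto
      also have "\<dots> \<le> C * \<epsilon>" using kt C0 by (intro mult_left_mono) auto
      also note \<epsilon>C
      finally have "norm (c (\<epsilon> * real k) - c t) \<le> \<delta> / 2" .
      with 1 have "norm (X \<epsilon> k - c t) \<le> \<delta> / 2 + \<delta> / 2"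
        unfolding e_def
        using norm_triangle_ineq[of "X \<epsilon> k - c (\<epsilon> * real k)" "c (\<epsilon> * real k) - c t"] by simp
      then show "norm (X \<epsilon> (nat \<lfloor>t / \<epsilon>\<rfloor>) - c t) \<le> \<delta>" by (simp add: k_def)
    qed
  qed
qed

section \<open>Almost sure convergence, probabilities and a diagonal horizon\<close>

text \<open>The null set in \<open>avg\<close> depends on \<open>z\<close>. Only the null sets of a
  countable dense set are discarded, and the Lipschitz bound, uniform in \<open>\<omega>\<close> and
  \<open>k\<close>, reaches all other points.\<close>

lemma (in prob_space) AE_averages_tendsto_all:
  fixes F :: "nat \<Rightarrow> 'c::euclidean_space \<Rightarrow> 'a \<Rightarrow> 'b::real_normed_vector"
  assumes lip: "\<And>D. compact D \<Longrightarrow> \<exists>L. \<forall>u\<in>D. \<forall>v\<in>D. \<forall>\<omega>\<in>space M. \<forall>k.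
      norm (F k u \<omega> - F k v \<omega>) \<le> L * norm (u - v)"
    and avg: "\<And>z. AE \<omega> in M. (\<lambda>N. (1 / real (N + 1)) *\<^sub>R (\<Sum>k\<le>N. F k z \<omega>)) \<longlonglongrightarrow> G z"
  shows "AE \<omega> in M. \<forall>z. (\<lambda>N. (1 / real (N + 1)) *\<^sub>R (\<Sum>k\<le>N. F k z \<omega>)) \<longlonglongrightarrow> G z"
proof -
  \<comment> \<open>\<open>G\<close> inherits the Lipschitz constant: any two of its values are limits of averages along one
    common sample point.\<close>
  have Glip: "norm (G u - G v) \<le> B"
    if B: "\<And>\<omega> k. \<omega> \<in> space M \<Longrightarrow> norm (F k u \<omega> - F k v \<omega>) \<le> B" for u v B
  proof -
    have "AE \<omega> in M. norm (G u - G v) \<le> B"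
      using avg[of u] avg[of v] AE_space[of M]
    proof eventually_elim
      case (elim \<omega>)
      show ?case by (rule norm_average_limits_diff_le[OF elim(1,2) B[OF elim(3)]])
    qed
    then show ?thesis by simp
  qed
  obtain Q :: "'c set" where Q: "countable Q" "closure Q = UNIV"
  proof -
    obtain Q :: "'c set" where Q: "countable Q" "\<And>U. open U \<Longrightarrow> U \<noteq> {} \<Longrightarrow> \<exists>q\<in>Q. q \<in> U"
      by (rule countable_dense_setE) blast
    have "z \<in> closure Q" for z
      unfolding closure_approachable using Q(2)[of "ball z _"] by (auto simp: dist_commute)
    then show ?thesis using that Q(1) by blast
  qed
  have "AE \<omega> in M. \<forall>q\<in>Q. (\<lambda>N. (1 / real (N + 1)) *\<^sub>R (\<Sum>k\<le>N. F k q \<omega>)) \<longlonglongrightarrow> G q"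
    unfolding AE_ball_countable[OF Q(1)] using avg by blast
  with AE_space[of M] show ?thesis
  proof eventually_elim
    case (elim \<omega>)
    show ?case
    proof (rule allI, rule averages_tendsto_of_dense[OF _ Q(2)])
      fix D :: "'c set" assume "compact D"
      from lip[OF this] obtain L where L: "\<forall>u\<in>D. \<forall>v\<in>D. \<forall>\<omega>\<in>space M. \<forall>k.
          norm (F k u \<omega> - F k v \<omega>) \<le> L * norm (u - v)" ..
      show "\<exists>L. \<forall>u\<in>D. \<forall>v\<in>D. (\<forall>k. norm (F k u \<omega> - F k v \<omega>) \<le> L * norm (u - v)) \<and>
          norm (G u - G v) \<le> L * norm (u - v)"
        using L elim(1) by (intro exI[of _ L] ballI conjI allI Glip) blast+
    qed (use elim(2) in blast)
  qed
qed

text \<open>Dominated convergence is applied along arbitrary positive null sequences: there the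
  indicators tend to 0 almost surely and are bounded by 1.\<close>

lemma (in finite_measure) measure_tendsto_0_at_right:
  assumes A: "\<And>\<epsilon>. A \<epsilon> \<in> sets M"
    and ae: "AE \<omega> in M. \<forall>\<^sub>F \<epsilon> in at_right (0::real). \<omega> \<notin> A \<epsilon>"
  shows "((\<lambda>\<epsilon>. measure M (A \<epsilon>)) \<longlongrightarrow> 0) (at_right 0)"
proof (rule tendsto_at_right_sequentially[of 0 1])
  fix S :: "nat \<Rightarrow> real"
  assume S: "\<And>n. 0 < S n" "S \<longlonglongrightarrow> 0"
  have lim: "filterlim S (at_right 0) sequentially"
    using S by (intro tendsto_imp_filterlim_at_right) auto
  have "(\<lambda>n. \<integral>\<omega>. indicat_real (A (S n)) \<omega> \<partial>M) \<longlonglongrightarrow> (\<integral>\<omega>. 0 \<partial>M)"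
  proof (rule integral_dominated_convergence[where w = "\<lambda>_. 1"])
    show "AE \<omega> in M. (\<lambda>n. indicat_real (A (S n)) \<omega>) \<longlonglongrightarrow> 0"
      using ae
    proof eventually_elim
      case (elim \<omega>)
      then have "\<forall>\<^sub>F n in sequentially. \<omega> \<notin> A (S n)"
        by (rule eventually_compose_filterlim[OF _ lim])
      then show ?case
        by (intro tendsto_eventually) (auto elim!: eventually_mono)
    qed
  qed (use A in \<open>auto simp: indicator_def\<close>)
  then show "(\<lambda>n. measure M (A (S n))) \<longlonglongrightarrow> 0"
    using A by simp
qed simp

text \<open>Take the largest \<open>N\<close> with \<open>P N \<epsilon>\<close> among those up to
  \<open>1 / \<epsilon>\<close>. The cap makes the maximum exist and itself tends to infinity, so
  every fixed \<open>N\<close> is eventually a candidate.\<close>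

lemma eventually_at_right_0_diagonal:
  assumes "\<And>N::nat. \<forall>\<^sub>F \<epsilon> in at_right (0::real). P N \<epsilon>"
  obtains T :: "real \<Rightarrow> nat"
  where "filterlim T at_top (at_right 0)" "\<forall>\<^sub>F \<epsilon> in at_right 0. P (T \<epsilon>) \<epsilon>"
proof
  define A where "A \<epsilon> = {N. N \<le> nat \<lfloor>1 / \<epsilon>\<rfloor> \<and> P N \<epsilon>}" for \<epsilon>
  define T where "T \<epsilon> = Max (A \<epsilon>)" for \<epsilon>
  have fin: "finite (A \<epsilon>)" for \<epsilon> by (simp add: A_def)
  have mem: "\<forall>\<^sub>F \<epsilon> in at_right 0. N \<in> A \<epsilon>" for N
  proof -
    have "\<forall>\<^sub>F \<epsilon> in at_right 0. \<epsilon> \<in> {0<..<1 / (real N + 1)}" by (rule eventually_at_right_real) simp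
    with assms[of N] show ?thesis
    proof eventually_elim
      case (elim \<epsilon>)
      then have "real N \<le> 1 / \<epsilon>" by (auto simp: field_simps)
      then have "N \<le> nat \<lfloor>1 / \<epsilon>\<rfloor>" by (simp add: le_nat_floor)
      then show ?case using elim by (simp add: A_def)
    qed
  qed
  show "filterlim T at_top (at_right 0)"
    unfolding filterlim_at_top
  proof
    fix N show "\<forall>\<^sub>F \<epsilon> in at_right 0. N \<le> T \<epsilon>"
      using mem[of N] by eventually_elim (use fin in \<open>auto simp: T_def\<close>)
  qed
  show "\<forall>\<^sub>F \<epsilon> in at_right 0. P (T \<epsilon>) \<epsilon>"
    \<comment> \<open>The candidate 0 ensures that the maximum is taken over a nonempty set and
      hence belongs to it.\<close>
    using mem[of 0]
  proof eventually_elim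
    case (elim \<epsilon>)
    then have "T \<epsilon> \<in> A \<epsilon>" unfolding T_def using fin by (intro Max_in) auto
    then show ?case by (simp add: A_def)
  qed
qed

section \<open>Measurability of the deviation events\<close>

lemma borel_measurable_Xd:
  fixes f :: "'a::euclidean_space \<Rightarrow> 'b::euclidean_space \<Rightarrow> 'a"
  assumes "\<And>k. Y k \<in> borel_measurable M" and "continuous_on UNIV (\<lambda>(z, y). f z y)"
  shows "Xd f Y \<epsilon> x k \<in> borel_measurable M"
proof (induction k)
  case 0
  have "Xd f Y \<epsilon> x 0 = (\<lambda>_. x)" by auto
  then show ?case by simp
next
  case (Suc k)
  have "(\<lambda>\<omega>. f (Xd f Y \<epsilon> x k \<omega>) (Y (Suc k) \<omega>)) \<in> borel_measurable M"
    by (rule borel_measurable_continuous_Pair[OF Suc assms(1)]) (use assms(2) in \<open>simp add: case_prod_beta'\<close>)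
  moreover have "Xd f Y \<epsilon> x (Suc k)
      = (\<lambda>\<omega>. Xd f Y \<epsilon> x k \<omega> + \<epsilon> *\<^sub>R f (Xd f Y \<epsilon> x k \<omega>) (Y (Suc k) \<omega>))" by auto
  ultimately show ?case using Suc by simp
qed

text \<open>Although \<open>t\<close> ranges over an uncountable set, on each interval of constancy the event is the
  preimage of an open set under a single \<open>Xd f Y \<epsilon> x k\<close>.\<close>

lemma sets_Xt_deviation:
  fixes f :: "'a::euclidean_space \<Rightarrow> 'b::euclidean_space \<Rightarrow> 'a"
  assumes "\<And>k. Y k \<in> borel_measurable M" and "continuous_on UNIV (\<lambda>(z, y). f z y)"
  shows "{\<omega> \<in> space M. \<exists>t\<in>I. norm (Xt f Y \<epsilon> x t \<omega> - c t) > \<delta>} \<in> sets M"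
proof -
  define U where "U k = (\<Union>t\<in>{t\<in>I. nat \<lfloor>t / \<epsilon>\<rfloor> = k}. {z. norm (z - c t) > \<delta>})" for k
  have "open (U k)" for k
    unfolding U_def by (intro open_UN ballI open_Collect_less continuous_intros)
  then have "Xd f Y \<epsilon> x k -` U k \<inter> space M \<in> sets M" for k
    using borel_measurable_Xd[OF assms] by (intro measurable_sets[where A = borel]) auto
  then have "(\<Union>k. Xd f Y \<epsilon> x k -` U k \<inter> space M) \<in> sets M" by blast
  also have "(\<Union>k. Xd f Y \<epsilon> x k -` U k \<inter> space M)
      = {\<omega> \<in> space M. \<exists>t\<in>I. norm (Xt f Y \<epsilon> x t \<omega> - c t) > \<delta>}"
    by (auto simp: U_def Xt_def)
  finally show ?thesis .
qed



section \<open>The averaging principle\<close>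

theorem theorem3:
  fixes M :: "'w measure"
    and f :: "real^'n \<Rightarrow> real^'m \<Rightarrow> real^'n"
    and Y :: "nat \<Rightarrow> 'w \<Rightarrow> real^'m"
    and SY :: "(real^'m) set"
    and \<mu> :: "(real^'m) measure"
    and x :: "real^'n"
    and Xc :: "real \<Rightarrow> real^'n"
    and \<epsilon>0 :: real
  assumes M_prob: "prob_space M"
    and M_complete: "complete_measure M"
    and eps0_pos: "\<epsilon>0 > 0"
    and Y_rv: "\<And>k. Y k \<in> borel_measurable M"
    and Y_SY: "\<And>k \<omega>. \<omega> \<in> space M \<Longrightarrow> Y k \<omega> \<in> SY"
    and A1_cont: "continuous_on UNIV (\<lambda>(z, y). f z y)"
    and A1_bdd: "\<And>z. bounded (range (f z))"
    and A1_lip: "\<And>D. compact D \<Longrightarrow> \<exists>k. \<forall>x1\<in>D. \<forall>x2\<in>D. \<forall>y\<in>SY.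
                    norm (f x1 y - f x2 y) \<le> k * norm (x1 - x2)"
    and mu_prob: "prob_space \<mu>"
    and mu_sets: "sets \<mu> = sets borel"
    and SY_meas: "SY \<in> sets borel"
    and mu_SY: "emeasure \<mu> SY = 1"
    and A2: "\<And>z. AE \<omega> in M.
               ((\<lambda>N. (1 / real (N + 1)) *\<^sub>R (\<Sum>k\<le>N. f z (Y (k + 1) \<omega>)))
                  \<longlongrightarrow> fbar f \<mu> SY z) sequentially"
    and A3_init: "Xc 0 = x"
    and A3_ode: "\<And>t. t \<ge> 0 \<Longrightarrow>
               (Xc has_vector_derivative fbar f \<mu> SY (Xc t)) (at t within {0..})"
  shows "(\<forall>\<delta>>0. AE \<omega> in M.
            ((\<lambda>\<epsilon>. Inf (ereal ` {t. t \<ge> 0 \<and> norm (Xt f Y \<epsilon> x t \<omega> - Xc t) > \<delta>}))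
               \<longlongrightarrow> \<infinity>) (at_right 0))
       \<and> (\<exists>T :: real \<Rightarrow> nat. filterlim T at_top (at_right 0) \<and>
            (\<forall>\<delta>>0. ((\<lambda>\<epsilon>. measure M {\<omega> \<in> space M.
                 (SUP t\<in>{0..real (T \<epsilon>)}. norm (Xt f Y \<epsilon> x t \<omega> - Xc t)) > \<delta>})
               \<longlongrightarrow> 0) (at_right 0)))"
proof -
  interpret prob_space M by (rule M_prob)
  have "AE \<omega> in M. \<forall>z. (\<lambda>N. (1 / real (N + 1)) *\<^sub>R (\<Sum>k\<le>N. f z (Y (k + 1) \<omega>))) \<longlonglongrightarrow> fbar f \<mu> SY z"
  proof (rule AE_averages_tendsto_all[OF _ A2])
    fix D :: "(real^'n) set" assume "compact D"
    then show "\<exists>L. \<forall>u\<in>D. \<forall>v\<in>D. \<forall>\<omega>\<in>space M. \<forall>k.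
        norm (f u (Y (k + 1) \<omega>) - f v (Y (k + 1) \<omega>)) \<le> L * norm (u - v)"
      using A1_lip[of D] Y_SY by meson
  qed
  with AE_space[of M] have path: "AE \<omega> in M. \<forall>T>0. \<forall>\<delta>>0. \<forall>\<^sub>F \<epsilon> in at_right 0. \<forall>t\<in>{0..T}.
      norm (Xt f Y \<epsilon> x t \<omega> - Xc t) \<le> \<delta>"
  proof eventually_elim
    case (elim \<omega>)
    show ?case
      unfolding Xt_def
    proof (intro allI impI)
      fix T \<delta> :: real assume "T > 0" "\<delta> > 0"
      show "\<forall>\<^sub>F \<epsilon> in at_right 0. \<forall>t\<in>{0..T}. norm (Xd f Y \<epsilon> x (nat \<lfloor>t / \<epsilon>\<rfloor>) \<omega> - Xc t) \<le> \<delta>"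
      \<comment> \<open>Step \<open>k\<close> of the recursion uses \<open>Y (k + 1)\<close>, and
        the ergodic averages carry the same shift.\<close>
      proof (rule averaging_pathwise[where F = "\<lambda>k z. f z (Y (k + 1) \<omega>)" and G = "fbar f \<mu> SY"
            and X = "\<lambda>\<epsilon> k. Xd f Y \<epsilon> x k \<omega>"])
        fix D :: "(real^'n) set" assume "compact D"
        then show "\<exists>L. \<forall>k. \<forall>u\<in>D. \<forall>v\<in>D.
            norm (f u (Y (k + 1) \<omega>) - f v (Y (k + 1) \<omega>)) \<le> L * norm (u - v)"
          using A1_lip[of D] Y_SY elim(1) by meson
      qed (use elim(2) A3_init A3_ode \<open>T > 0\<close> \<open>\<delta> > 0\<close> in auto)
    qed
  qed
  have part1: "AE \<omega> in M.
      ((\<lambda>\<epsilon>. Inf (ereal ` {t. t \<ge> 0 \<and> norm (Xt f Y \<epsilon> x t \<omega> - Xc t) > \<delta>})) \<longlongrightarrow> \<infinity>) (at_right 0)"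
    if "\<delta> > 0" for \<delta>
    using path
  proof eventually_elim
    case (elim \<omega>)
    show ?case
      unfolding tendsto_PInfty
    proof
      fix r :: real
      \<comment> \<open>The horizon \<open>\<bar>r\<bar> + 1\<close> is positive and exceeds
        \<open>r\<close> for either sign of \<open>r\<close>. Without a deviation up to this time,
        the infimum is at least the horizon, also when the set is empty and the infimum is
        \<open>\<infinity>\<close>.\<close>
      have "\<forall>\<^sub>F \<epsilon> in at_right 0. \<forall>t\<in>{0..\<bar>r\<bar> + 1}. norm (Xt f Y \<epsilon> x t \<omega> - Xc t) \<le> \<delta>"
        using elim \<open>\<delta> > 0\<close> by simp
      then show "\<forall>\<^sub>F \<epsilon> in at_right 0.
          ereal r < Inf (ereal ` {t. t \<ge> 0 \<and> norm (Xt f Y \<epsilon> x t \<omega> - Xc t) > \<delta>})"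
      proof eventually_elim
        case (elim \<epsilon>)
        have "ereal r < ereal (\<bar>r\<bar> + 1)" by simp
        also have "\<dots> \<le> Inf (ereal ` {t. t \<ge> 0 \<and> norm (Xt f Y \<epsilon> x t \<omega> - Xc t) > \<delta>})"
          using elim by (intro INF_greatest) force
        finally show ?case .
      qed
    qed
  qed
  \<comment> \<open>The deviation level shrinks with \<open>N\<close> together with the horizon
    growing, so that one function \<open>T\<close> serves every \<open>\<delta>\<close>.\<close>
  define A where "A N \<epsilon> = {\<omega> \<in> space M. \<exists>t\<in>{0..real N}.
      norm (Xt f Y \<epsilon> x t \<omega> - Xc t) > 1 / (real N + 1)}" for N \<epsilon>
  have A_sets: "A N \<epsilon> \<in> sets M" for N \<epsilon>
    unfolding A_def by (rule sets_Xt_deviation[OF Y_rv A1_cont])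
  have "\<forall>\<^sub>F \<epsilon> in at_right 0. measure M (A N \<epsilon>) < 1 / (real N + 1)" for N
  proof -
    have "AE \<omega> in M. \<forall>\<^sub>F \<epsilon> in at_right 0. \<omega> \<notin> A N \<epsilon>"
      using path
    proof eventually_elim
      case (elim \<omega>)
      \<comment> \<open>The horizon is enlarged by 1 because \<open>path\<close> asks for a positive
        one and \<open>N\<close> may be 0.\<close>
      then have "\<forall>\<^sub>F \<epsilon> in at_right 0. \<forall>t\<in>{0..real N + 1}.
          norm (Xt f Y \<epsilon> x t \<omega> - Xc t) \<le> 1 / (real N + 1)" by simp
      then show ?case
        by eventually_elim (force simp: A_def not_less)
    qed
    then have "((\<lambda>\<epsilon>. measure M (A N \<epsilon>)) \<longlongrightarrow> 0) (at_right 0)"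
      by (rule measure_tendsto_0_at_right[OF A_sets])
    then show ?thesis by (rule order_tendstoD) simp
  qed
  then obtain T where T: "filterlim T at_top (at_right 0)"
      "\<forall>\<^sub>F \<epsilon> in at_right 0. measure M (A (T \<epsilon>) \<epsilon>) < 1 / (real (T \<epsilon>) + 1)"
    by (rule eventually_at_right_0_diagonal)
  have T_inv: "((\<lambda>\<epsilon>. 1 / (real (T \<epsilon>) + 1)) \<longlongrightarrow> 0) (at_right 0)"
    using filterlim_compose[OF LIMSEQ_inverse_real_of_nat T(1)]
    by (simp add: inverse_eq_divide add.commute)
  have part2: "((\<lambda>\<epsilon>. measure M {\<omega> \<in> space M.
      (SUP t\<in>{0..real (T \<epsilon>)}. norm (Xt f Y \<epsilon> x t \<omega> - Xc t)) > \<delta>}) \<longlongrightarrow> 0) (at_right 0)"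
    if "\<delta> > 0" for \<delta>
  proof (rule tendsto_sandwich[OF _ _ tendsto_const T_inv])
    have "\<forall>\<^sub>F \<epsilon> in at_right 0. 1 / (real (T \<epsilon>) + 1) < \<delta>"
      using T_inv \<open>\<delta> > 0\<close> by (rule order_tendstoD)
    with T(2) show "\<forall>\<^sub>F \<epsilon> in at_right 0. measure M {\<omega> \<in> space M.
        (SUP t\<in>{0..real (T \<epsilon>)}. norm (Xt f Y \<epsilon> x t \<omega> - Xc t)) > \<delta>} \<le> 1 / (real (T \<epsilon>) + 1)"
    proof eventually_elim
      case (elim \<epsilon>)
      \<comment> \<open>Once \<open>1 / (T \<epsilon> + 1)\<close> is below \<open>\<delta>\<close>,
        a supremum above \<open>\<delta>\<close> forces some time with a deviation beyond that
        level. Monotonicity of the measure then uses measurability of the larger set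
        \<open>A (T \<epsilon>) \<epsilon>\<close>.\<close>
      have "{\<omega> \<in> space M. (SUP t\<in>{0..real (T \<epsilon>)}. norm (Xt f Y \<epsilon> x t \<omega> - Xc t)) > \<delta>} \<subseteq> A (T \<epsilon>) \<epsilon>"
      proof
        fix \<omega> assume \<omega>: "\<omega> \<in> {\<omega> \<in> space M. (SUP t\<in>{0..real (T \<epsilon>)}. norm (Xt f Y \<epsilon> x t \<omega> - Xc t)) > \<delta>}"
        have "\<exists>t\<in>{0..real (T \<epsilon>)}. norm (Xt f Y \<epsilon> x t \<omega> - Xc t) > \<delta>"
        proof (rule ccontr)
          assume "\<not> ?thesis"
          then have "(SUP t\<in>{0..real (T \<epsilon>)}. norm (Xt f Y \<epsilon> x t \<omega> - Xc t)) \<le> \<delta>"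
            by (intro cSUP_least) (auto simp: not_less)
          with \<omega> show False by simp
        qed
        with \<omega> elim(2) show "\<omega> \<in> A (T \<epsilon>) \<epsilon>" unfolding A_def by force
      qed
      from finite_measure_mono[OF this A_sets] elim(1) show ?case by linarith
    qed
  qed simp
  show ?thesis
    using part1 part2 T(1) by blast
qed

end
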